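(* Let $Y\in sp(4)$ or $Y\in\widehat{sp}(4)$. Then the minimal polynomial of $Y$ is one of the following: - $x$, which happens iff $Y=0$; - $x^2+\frac{\|Y\|_F^2}{4}$, which happens iff $Y\neq0$ and $\|Y\|_F^4=16\det(Y)$; - $x^3+\frac12\|Y\|_F^2\,x$, which happens iff $Y\ne0$ but $\det(Y)=0$; - $x^4+\frac12\|Y\|_F^2\,x^2+\det(Y)$, which happens iff $Y\neq0$ and $\det(Y)\neq0$.
   Context: $J_{2n}=\begin{pmatrix}0_n&I_n\\-I_n&0_n\end{pmatrix}$, $\widehat{J}_4=J_2\oplus(-J_2)$. $sp(4)=\{X\in M(4,\mathbb{C}): X^*=-X,\ X^TJ_4=-J_4X\}$ and $\widehat{sp}(4)=\{X\in M(4,\mathbb{C}): X^*=-X,\ X^T\widehat{J}_4=-\widehat{J}_4X\}$, where $X^*$ is the conjugate transpose. $\|X\|_F=\sqrt{\mathrm{Tr}(X^*X)}$ is the Frobenius norm. The minimal polynomial is the monic complex polynomial of least degree annihilating the matrix.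
   Formalization: In the fourth case the condition also requires ‖Y‖_F^4 ≠ 16 det(Y); as written it overlaps with the second case, e.g. Y = diag(i,i,−i,−i) in sp(4) has minimal polynomial x²+1 although Y ≠ 0 and det(Y) = 1 ≠ 0. *)

theory Defs
  imports "Jordan_Normal_Form.Schur_Decomposition"
begin

text \<open>\<open>J_mat n\<close> is $J_{2n}$: its index is half its size.\<close>

definition J_mat :: "nat \<Rightarrow> complex mat" where
  "J_mat n = four_block_mat (0\<^sub>m n n) (1\<^sub>m n) (- 1\<^sub>m n) (0\<^sub>m n n)"

definition J4_hat :: "complex mat" where
  "J4_hat = diag_block_mat [J_mat 1, - J_mat 1]"

definition sp4 :: "complex mat set" where
  "sp4 = {X \<in> carrier_mat 4 4. mat_adjoint X = - X \<and> X\<^sup>T * J_mat 2 = - J_mat 2 * X}"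

definition sp4_hat :: "complex mat set" where
  "sp4_hat = {X \<in> carrier_mat 4 4. mat_adjoint X = - X \<and> X\<^sup>T * J4_hat = - J4_hat * X}"

definition mat_trace :: "'a :: comm_monoid_add mat \<Rightarrow> 'a" where
  "mat_trace A = (\<Sum>i<dim_row A. A $$ (i, i))"

text \<open>The trace below is a nonnegative real number, so taking its real part loses nothing
  (lemma \<open>frobenius_norm_squared\<close>).\<close>

definition frobenius_norm :: "complex mat \<Rightarrow> real" where
  "frobenius_norm A = sqrt (Re (mat_trace (mat_adjoint A * A)))"

text \<open>$p(A)$ for square \<open>A\<close>. It is given entrywise because matrices of variable size do not form
  a type-class ring over which \<^const>\<open>sum\<close> could range.\<close>

definition poly_mat :: "'a :: comm_ring_1 poly \<Rightarrow> 'a mat \<Rightarrow> 'a mat" where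
  "poly_mat p A = mat (dim_row A) (dim_row A)
     (\<lambda>(i, j). \<Sum>k\<le>degree p. coeff p k * (A ^\<^sub>m k) $$ (i, j))"

definition annihilates :: "'a :: comm_ring_1 poly \<Rightarrow> 'a mat \<Rightarrow> bool" where
  "annihilates p A \<longleftrightarrow> poly_mat p A = 0\<^sub>m (dim_row A) (dim_row A)"

definition is_min_poly :: "'a :: field poly \<Rightarrow> 'a mat \<Rightarrow> bool" where
  "is_min_poly p A \<longleftrightarrow> monic p \<and> annihilates p A \<and>
     (\<forall>q. monic q \<and> annihilates q A \<longrightarrow> degree p \<le> degree q)"

definition min_poly :: "'a :: field mat \<Rightarrow> 'a poly" where
  "min_poly A = (THE p. is_min_poly p A)"

lemma frobenius_norm_squared:
  "complex_of_real ((frobenius_norm A)\<^sup>2) = mat_trace (mat_adjoint A * A)"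
proof -
  let ?S = "\<Sum>i<dim_col A. \<Sum>k<dim_row A. (cmod (A $$ (k, i)))\<^sup>2"
  have "mat_trace (mat_adjoint A * A) = complex_of_real ?S"
    by (auto simp: mat_trace_def mat_adjoint_def mat_of_rows_def scalar_prod_def
        complex_norm_square[symmetric] of_real_power[symmetric] lessThan_atLeast0 mult.commute
        simp del: of_real_power intro!: sum.cong)
  moreover have "?S \<ge> 0"
    by (intro sum_nonneg) auto
  ultimately show ?thesis
    by (simp add: frobenius_norm_def)
qed

lemma annihilates_iff:
  assumes "degree p \<le> N"
  shows "annihilates p A \<longleftrightarrow>
    (\<forall>i<dim_row A. \<forall>j<dim_row A. (\<Sum>k\<le>N. coeff p k * (A ^\<^sub>m k) $$ (i, j)) = 0)"
proof -
  have "(\<Sum>k\<le>degree p. coeff p k * (A ^\<^sub>m k) $$ (i, j)) = (\<Sum>k\<le>N. coeff p k * (A ^\<^sub>m k) $$ (i, j))"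
    for i j
    by (rule sum.mono_neutral_left) (use assms in \<open>auto simp: coeff_eq_0\<close>)
  then show ?thesis
    by (auto simp: annihilates_def poly_mat_def mat_eq_iff)
qed

lemma min_poly_eqI:
  assumes "is_min_poly p A"
  shows "min_poly A = p"
  unfolding min_poly_def
proof (rule the_equality[where P = "\<lambda>p. is_min_poly p A", OF assms])
  fix q assume q: "is_min_poly q A"
  have deg: "degree q = degree p"
    using assms q by (auto simp: is_min_poly_def intro!: antisym)
  show "q = p"
  proof (rule ccontr)
    assume "q \<noteq> p"
    define r where "r = q - p"
    define s where "s = smult (inverse (lead_coeff r)) r"
    have r0: "r \<noteq> 0"
      using \<open>q \<noteq> p\<close> by (simp add: r_def)
    have "degree r \<le> degree p"
      using deg by (simp add: r_def degree_diff_le)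
    moreover have "coeff r (degree p) = 0"
      using assms q deg by (simp add: r_def is_min_poly_def)
    ultimately have "degree r < degree p"
      using r0 by (metis le_neq_implies_less leading_coeff_0_iff)
    moreover have "degree s = degree r" "monic s"
      using r0 by (simp_all add: s_def)
    moreover have "annihilates s A"
    proof -
      let ?N = "degree p"
      have "(\<Sum>k\<le>?N. coeff s k * (A ^\<^sub>m k) $$ (i, j)) = 0"
        if "i < dim_row A" "j < dim_row A" for i j
      proof -
        have "(\<Sum>k\<le>?N. coeff s k * (A ^\<^sub>m k) $$ (i, j)) = inverse (lead_coeff r) *
          ((\<Sum>k\<le>?N. coeff q k * (A ^\<^sub>m k) $$ (i, j)) - (\<Sum>k\<le>?N. coeff p k * (A ^\<^sub>m k) $$ (i, j)))"
          by (simp add: s_def r_def sum_distrib_left flip: sum_subtractf)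
            (simp add: algebra_simps)
        then show ?thesis
          using assms q that annihilates_iff[of q ?N A] annihilates_iff[of p ?N A] deg
          by (simp add: is_min_poly_def)
      qed
      then show ?thesis
        using annihilates_iff[of s ?N A] \<open>degree s = degree r\<close> \<open>degree r < degree p\<close> by simp
    qed
    ultimately show False
      using assms unfolding is_min_poly_def by (metis not_less)
  qed
qed

end

(* For skew-Hermitian Y the squared Frobenius norm of p(Y) is a combination of traces of powers of
   Y, and every polynomial annihilating Y satisfies the linear system given by the Hankel matrix of
   these traces. So the minimal polynomial can be read off the traces. The symplectic relation makes
   Y^2 self-adjoint for the symplectic form, which yields Y^4 = tr(Y^2)/2 Y^2 - det Y, and Y and Y^3
   traceless; with tr Y^2 = -|Y|^2 this determines all traces. The relevant Hankel determinants are,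
   up to constants, |Y|^4 - 16 det Y and det Y (|Y|^4 - 16 det Y). *)

theory Submission
  imports Defs
begin

section \<open>Products and determinants of 4 x 4 matrices\<close>

lemma index_mult_mat_4:
  fixes A B :: "'a::comm_ring_1 mat"
  assumes "A \<in> carrier_mat 4 4" "B \<in> carrier_mat 4 4" "i < 4" "j < 4"
  shows "(A * B) $$ (i, j) = A $$ (i, 0) * B $$ (0, j) + A $$ (i, 1) * B $$ (1, j)
    + A $$ (i, 2) * B $$ (2, j) + A $$ (i, 3) * B $$ (3, j)"
  using assms by (auto simp: scalar_prod_def numeral_eq_Suc)

text \<open>Laplace expansion along the first two rows, as products of complementary 2 x 2 minors.
  The proof expands one row at a time, through the sizes 3 and 2.\<close>

lemma det_4:
  fixes A :: "'a::comm_ring_1 mat"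
  assumes A: "A \<in> carrier_mat 4 4"
  shows "det A =
     (A $$ (0,0) * A $$ (1,1) - A $$ (0,1) * A $$ (1,0)) * (A $$ (2,2) * A $$ (3,3) - A $$ (2,3) * A $$ (3,2))
   - (A $$ (0,0) * A $$ (1,2) - A $$ (0,2) * A $$ (1,0)) * (A $$ (2,1) * A $$ (3,3) - A $$ (2,3) * A $$ (3,1))
   + (A $$ (0,0) * A $$ (1,3) - A $$ (0,3) * A $$ (1,0)) * (A $$ (2,1) * A $$ (3,2) - A $$ (2,2) * A $$ (3,1))
   + (A $$ (0,1) * A $$ (1,2) - A $$ (0,2) * A $$ (1,1)) * (A $$ (2,0) * A $$ (3,3) - A $$ (2,3) * A $$ (3,0))
   - (A $$ (0,1) * A $$ (1,3) - A $$ (0,3) * A $$ (1,1)) * (A $$ (2,0) * A $$ (3,2) - A $$ (2,2) * A $$ (3,0))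
   + (A $$ (0,2) * A $$ (1,3) - A $$ (0,3) * A $$ (1,2)) * (A $$ (2,0) * A $$ (3,1) - A $$ (2,1) * A $$ (3,0))"
proof -
  have 3: "det B = B $$ (0,0) * (B $$ (1,1) * B $$ (2,2) - B $$ (1,2) * B $$ (2,1))
      - B $$ (0,1) * (B $$ (1,0) * B $$ (2,2) - B $$ (1,2) * B $$ (2,0))
      + B $$ (0,2) * (B $$ (1,0) * B $$ (2,1) - B $$ (1,1) * B $$ (2,0))"
    if B: "B \<in> carrier_mat 3 3" for B :: "'a mat"
  proof -
    have 2: "det C = C $$ (0,0) * C $$ (1,1) - C $$ (0,1) * C $$ (1,0)"
      if C: "C \<in> carrier_mat 2 2" for C :: "'a mat"
      using C laplace_expansion_row[OF C, of 0]
      by (simp add: numeral_eq_Suc cofactor_def det_single mat_delete_def)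
    show ?thesis
      using B laplace_expansion_row[OF B, of 0]
      by (simp add: numeral_eq_Suc cofactor_def 2[unfolded numeral_eq_Suc, simplified]
        mat_delete_def algebra_simps)
  qed
  show ?thesis
    using A laplace_expansion_row[OF A, of 0]
    by (simp add: numeral_eq_Suc cofactor_def 3[unfolded numeral_eq_Suc, simplified]
        mat_delete_def algebra_simps)
qed

section \<open>Matrices compatible with a symplectic form\<close>

lemma index_J_mat_2:
  assumes "i < 4" "j < 4"
  shows "J_mat 2 $$ (i, j) = (if j = i + 2 then 1 else if i = j + 2 then -1 else 0)"
  using assms by (auto simp: J_mat_def)

lemma index_J4_hat:
  assumes "i < 4" "j < 4"
  shows "J4_hat $$ (i, j) =
    (if (i, j) \<in> {(0,1), (3,2)} then 1 else if (i, j) \<in> {(1,0), (2,3)} then -1 else 0)"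
  using assms by (auto simp: J4_hat_def J_mat_def Let_def numeral_eq_Suc less_Suc_eq)

lemma pow_mat_add:
  fixes A :: "'a::semiring_1 mat"
  assumes "A \<in> carrier_mat n n"
  shows "A ^\<^sub>m (k + m) = A ^\<^sub>m k * A ^\<^sub>m m"
proof (induction m)
  case (Suc m)
  then show ?case
    using assms assoc_mult_mat[of "A ^\<^sub>m k" n n "A ^\<^sub>m m" n A n] by simp
qed (use assms in simp)

text \<open>\<open>J_mat 2\<close> is antisymmetric, so the relation means that
  \<open>J_mat 2 * X\<close> is symmetric; the six equations compare its entries across the
  diagonal. In blocks, X = (A, B; C, -A^T) with B and C symmetric.\<close>

lemma J_mat_2_relations:
  assumes X: "X \<in> carrier_mat 4 4" and eq: "X\<^sup>T * J_mat 2 = - J_mat 2 * X"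
  shows "X $$ (2,2) = - X $$ (0,0)" "X $$ (2,3) = - X $$ (1,0)" "X $$ (3,2) = - X $$ (0,1)"
    "X $$ (3,3) = - X $$ (1,1)" "X $$ (1,2) = X $$ (0,3)" "X $$ (3,0) = X $$ (2,1)"
proof -
  have J: "J_mat 2 \<in> carrier_mat 4 4"
    by (auto simp: J_mat_def)
  have "(X\<^sup>T * J_mat 2) $$ (i, j) = (- J_mat 2 * X) $$ (i, j)" for i j
    using eq by simp
  from this[of 0 0] this[of 0 1] this[of 0 2] this[of 0 3] this[of 1 2] this[of 1 3] this[of 2 3]
  show "X $$ (2,2) = - X $$ (0,0)" "X $$ (2,3) = - X $$ (1,0)" "X $$ (3,2) = - X $$ (0,1)"
    "X $$ (3,3) = - X $$ (1,1)" "X $$ (1,2) = X $$ (0,3)" "X $$ (3,0) = X $$ (2,1)"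
    using X J by (simp_all add: index_mult_mat_4 index_J_mat_2 del: index_mult_mat(1) One_nat_def)
qed

text \<open>Again \<open>J4_hat * X\<close> is symmetric. In 2 x 2 blocks, the diagonal blocks are
  traceless and the lower left block is the adjugate of the upper right one.\<close>

lemma J4_hat_relations:
  assumes X: "X \<in> carrier_mat 4 4" and eq: "X\<^sup>T * J4_hat = - J4_hat * X"
  shows "X $$ (1,1) = - X $$ (0,0)" "X $$ (3,0) = - X $$ (1,2)" "X $$ (2,0) = X $$ (1,3)"
    "X $$ (3,1) = X $$ (0,2)" "X $$ (2,1) = - X $$ (0,3)" "X $$ (3,3) = - X $$ (2,2)"
proof -
  have J: "J4_hat \<in> carrier_mat 4 4"
    by (auto simp: J_mat_def J4_hat_def Let_def)
  have "(X\<^sup>T * J4_hat) $$ (i, j) = (- J4_hat * X) $$ (i, j)" for i j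
    using eq by simp
  from this[of 0 0] this[of 0 1] this[of 0 2] this[of 0 3] this[of 1 2] this[of 1 3] this[of 2 3]
  show "X $$ (1,1) = - X $$ (0,0)" "X $$ (3,0) = - X $$ (1,2)" "X $$ (2,0) = X $$ (1,3)"
    "X $$ (3,1) = X $$ (0,2)" "X $$ (2,1) = - X $$ (0,3)" "X $$ (3,3) = - X $$ (2,2)"
    using X J by (simp_all add: index_mult_mat_4 index_J4_hat eq_neg_iff_add_eq_0
       neg_eq_iff_add_eq_0 add.commute
       del: index_mult_mat(1) One_nat_def)
qed

text \<open>For either form J, X^T = -J X J^-1, so odd powers of \<open>X\<close> are traceless. For
  Z = X^2 the matrix J Z is antisymmetric, so \<open>Z\<close> is a root of Pf(x J - J Z) / Pf J =
  x^2 - (tr Z / 2) x + Pf(J Z) / Pf J, and this constant term is \<open>det X\<close>. The proof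
  checks these identities entrywise.\<close>

lemma symplectic_powers:
  assumes X: "X \<in> carrier_mat 4 4"
    and eq: "X\<^sup>T * J_mat 2 = - J_mat 2 * X \<or> X\<^sup>T * J4_hat = - J4_hat * X"
  shows "mat_trace X = 0" "mat_trace (X ^\<^sub>m 3) = 0"
    "\<And>i j. i < 4 \<Longrightarrow> j < 4 \<Longrightarrow> (X ^\<^sub>m 4) $$ (i, j) =
      mat_trace (X ^\<^sub>m 2) / 2 * (X ^\<^sub>m 2) $$ (i, j) - det X * (if i = j then 1 else 0)"
proof -
  define Z where "Z = X * X"
  have Z: "Z \<in> carrier_mat 4 4"
    using X by (simp add: Z_def)
  have pow: "X ^\<^sub>m 2 = Z" "X ^\<^sub>m 3 = Z * X" "X ^\<^sub>m 4 = Z * Z"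
    using X pow_mat_add[OF X, of 2 2] by (simp_all add: Z_def numeral_eq_Suc)
  have Z_ind: "Z $$ (i, j) = X $$ (i, 0) * X $$ (0, j) + X $$ (i, 1) * X $$ (1, j)
    + X $$ (i, 2) * X $$ (2, j) + X $$ (i, 3) * X $$ (3, j)" if "i < 4" "j < 4" for i j
    unfolding Z_def using index_mult_mat_4[OF X X that] .
  have tr: "mat_trace A = A $$ (0,0) + A $$ (1,1) + A $$ (2,2) + A $$ (3,3)"
    if "A \<in> carrier_mat 4 4" for A :: "complex mat"
    using that by (simp add: mat_trace_def numeral_eq_Suc)
  have ZX: "Z * X \<in> carrier_mat 4 4" using Z X by simp
  have less4: "i < 4 \<longleftrightarrow> i = 0 \<or> i = 1 \<or> i = 2 \<or> i = 3" for i :: nat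
    by auto
  from eq have "mat_trace X = 0 \<and> mat_trace (X ^\<^sub>m 3) = 0 \<and> (\<forall>i<4. \<forall>j<4. (X ^\<^sub>m 4) $$ (i, j) =
      mat_trace (X ^\<^sub>m 2) / 2 * (X ^\<^sub>m 2) $$ (i, j) - det X * (if i = j then 1 else 0))"
  proof
    assume "X\<^sup>T * J_mat 2 = - J_mat 2 * X"
    note rel = J_mat_2_relations[OF X this]
    \<comment> \<open>Antisymmetry of \<open>J_mat 2 * Z\<close>: zero diagonal and six opposite
      pairs, which leaves six free entries of \<open>Z\<close>.\<close>
    have z: "Z $$ (0,2) = 0" "Z $$ (1,3) = 0" "Z $$ (2,0) = 0" "Z $$ (3,1) = 0"
      "Z $$ (1,2) = - Z $$ (0,3)" "Z $$ (3,0) = - Z $$ (2,1)" "Z $$ (2,2) = Z $$ (0,0)"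
      "Z $$ (3,3) = Z $$ (1,1)" "Z $$ (2,3) = Z $$ (1,0)" "Z $$ (3,2) = Z $$ (0,1)"
      by (simp_all add: Z_ind rel algebra_simps del: One_nat_def)
    \<comment> \<open>The right-hand side is Pf(J Z) / Pf J, where Pf J = -1.\<close>
    have d: "det X = Z $$ (0,0) * Z $$ (1,1) - Z $$ (0,1) * Z $$ (1,0) + Z $$ (0,3) * Z $$ (2,1)"
      by (simp add: det_4[OF X] Z_ind rel algebra_simps del: One_nat_def)
    have "(Z * Z) $$ (i, j) = mat_trace Z / 2 * Z $$ (i, j) - det X * (if i = j then 1 else 0)"
      if ij: "i < 4" "j < 4" for i j
      using ij unfolding less4
      \<comment> \<open>Sixteen concrete entries, each a polynomial identity in the free entries of
        \<open>Z\<close>.\<close>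
      by (elim disjE; hypsubst)
        (simp_all add: index_mult_mat_4[OF Z Z] tr[OF Z] d z field_simps
          del: One_nat_def index_mult_mat(1))
    then show ?thesis
      using X by (simp add: pow tr[OF X] tr[OF ZX] index_mult_mat_4[OF Z X] Z_ind rel algebra_simps
          del: index_mult_mat(1) One_nat_def)
  next
    assume "X\<^sup>T * J4_hat = - J4_hat * X"
    note rel = J4_hat_relations[OF X this]
    \<comment> \<open>Ten relations again, now from antisymmetry of
      \<open>J4_hat * Z\<close>.\<close>
    have z: "Z $$ (0,1) = 0" "Z $$ (1,0) = 0" "Z $$ (2,3) = 0" "Z $$ (3,2) = 0"
      "Z $$ (3,1) = - Z $$ (0,2)" "Z $$ (2,0) = - Z $$ (1,3)" "Z $$ (1,1) = Z $$ (0,0)"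
      "Z $$ (2,2) = Z $$ (3,3)" "Z $$ (1,2) = Z $$ (3,0)" "Z $$ (2,1) = Z $$ (0,3)"
      by (simp_all add: Z_ind rel algebra_simps del: One_nat_def)
    have d: "det X = Z $$ (0,0) * Z $$ (3,3) - Z $$ (0,3) * Z $$ (3,0) + Z $$ (0,2) * Z $$ (1,3)"
      by (simp add: det_4[OF X] Z_ind rel algebra_simps del: One_nat_def)
    have "(Z * Z) $$ (i, j) = mat_trace Z / 2 * Z $$ (i, j) - det X * (if i = j then 1 else 0)"
      if ij: "i < 4" "j < 4" for i j
      using ij unfolding less4
      by (elim disjE; hypsubst)
        (simp_all add: index_mult_mat_4[OF Z Z] tr[OF Z] d z field_simps
          del: One_nat_def index_mult_mat(1))
    then show ?thesis
      using X by (simp add: pow tr[OF X] tr[OF ZX] index_mult_mat_4[OF Z X] Z_ind rel algebra_simps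
          del: index_mult_mat(1) One_nat_def)
  qed
  then show "mat_trace X = 0" "mat_trace (X ^\<^sub>m 3) = 0"
    "\<And>i j. i < 4 \<Longrightarrow> j < 4 \<Longrightarrow> (X ^\<^sub>m 4) $$ (i, j) =
      mat_trace (X ^\<^sub>m 2) / 2 * (X ^\<^sub>m 2) $$ (i, j) - det X * (if i = j then 1 else 0)"
    by auto
qed

section \<open>Traces of powers and annihilating polynomials\<close>

lemma mat_trace_mult:
  fixes A B :: "'a::comm_ring_1 mat"
  assumes "A \<in> carrier_mat n n" "B \<in> carrier_mat n n"
  shows "mat_trace (A * B) = (\<Sum>i<n. \<Sum>j<n. A $$ (i, j) * B $$ (j, i))"
  using assms by (auto simp: mat_trace_def scalar_prod_def lessThan_atLeast0 intro!: sum.cong)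

lemma sum_swap_twice:
  "(\<Sum>k\<in>K. \<Sum>i\<in>I. \<Sum>j\<in>J. f k i j) = (\<Sum>i\<in>I. \<Sum>j\<in>J. \<Sum>k\<in>K. f k i j)"
  by (subst sum.swap, rule sum.cong[OF refl], rule sum.swap)

text \<open>Multiply q(A) = 0 by A^m and take the trace. Letting \<open>m\<close> vary gives the
  rows of a Hankel system for the coefficients of \<open>q\<close>; a bound \<open>N\<close> above
  the degree only adds zero terms.\<close>

lemma annihilates_imp_trace_sum_eq_0:
  fixes A :: "'a::comm_ring_1 mat"
  assumes A: "A \<in> carrier_mat n n" and "annihilates q A" "degree q \<le> N"
  shows "(\<Sum>k\<le>N. coeff q k * mat_trace (A ^\<^sub>m (k + m))) = 0"
proof -
  have "(\<Sum>k\<le>N. coeff q k * mat_trace (A ^\<^sub>m (k + m))) =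
    (\<Sum>k\<le>N. \<Sum>i<n. \<Sum>j<n. coeff q k * (A ^\<^sub>m k) $$ (i, j) * (A ^\<^sub>m m) $$ (j, i))"
    using A by (simp add: pow_mat_add[OF A] mat_trace_mult[of _ n] sum_distrib_left mult.assoc)
  also have "\<dots> = (\<Sum>i<n. \<Sum>j<n. (\<Sum>k\<le>N. coeff q k * (A ^\<^sub>m k) $$ (i, j)) * (A ^\<^sub>m m) $$ (j, i))"
    by (subst sum_swap_twice) (simp only: sum_distrib_right)
  also have "\<dots> = 0"
    using annihilates_iff[OF assms(3), of A] assms(1,2) by simp
  finally show ?thesis .
qed

lemma index_mat_adjoint:
  assumes "A \<in> carrier_mat n m" "i < m" "j < n"
  shows "mat_adjoint A $$ (i, j) = conjugate (A $$ (j, i))"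
  using assms by (simp add: mat_adjoint_def mat_of_rows_def)

lemma skew_hermitian_pow:
  fixes A :: "complex mat"
  assumes A: "A \<in> carrier_mat n n" and skew: "mat_adjoint A = - A"
    and ij: "i < n" "j < n"
  shows "(A ^\<^sub>m k) $$ (j, i) = (-1) ^ k * cnj ((A ^\<^sub>m k) $$ (i, j))"
  using ij
proof (induction k arbitrary: i j)
  case 0
  then show ?case using A by auto
next
  case (Suc k)
  have A_ji: "A $$ (j, i) = - cnj (A $$ (i, j))" if "i < n" "j < n" for i j
    using index_mat_adjoint[OF A that(2,1)] A that by (simp add: skew) (metis minus_minus)
  \<comment> \<open>Adjoints reverse products: the new factor stands on the left for the entry (j,
    i) and on the right for (i, j).\<close>
  have "A ^\<^sub>m Suc k = A * A ^\<^sub>m k"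
    using pow_mat_add[OF A, of 1 k] A by simp
  then have "(A ^\<^sub>m Suc k) $$ (j, i) = (\<Sum>l<n. A $$ (j, l) * (A ^\<^sub>m k) $$ (l, i))"
    using A Suc.prems by (simp add: scalar_prod_def lessThan_atLeast0)
  also have "\<dots> = (\<Sum>l<n. (-1) ^ Suc k * cnj ((A ^\<^sub>m k) $$ (i, l) * A $$ (l, j)))"
    using Suc.prems by (intro sum.cong) (simp_all add: A_ji[of _ j] Suc.IH[of i])
  also have "\<dots> = (-1) ^ Suc k * cnj ((A ^\<^sub>m Suc k) $$ (i, j))"
    using A Suc.prems by (simp add: scalar_prod_def lessThan_atLeast0 sum_distrib_left sum_negf)
  finally show ?case .
qed

text \<open>The hypothesis says that the squared Frobenius norm of $p(A)$ vanishes.\<close>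

lemma skew_hermitian_annihilatesI:
  fixes A :: "complex mat"
  assumes A: "A \<in> carrier_mat n n" and skew: "mat_adjoint A = - A" and deg: "degree p \<le> N"
    and zero: "(\<Sum>k\<le>N. \<Sum>l\<le>N.
      coeff p k * cnj (coeff p l) * (-1) ^ l * mat_trace (A ^\<^sub>m (k + l))) = 0"
  shows "annihilates p A"
proof -
  define P where "P i j = (\<Sum>k\<le>N. coeff p k * (A ^\<^sub>m k) $$ (i, j))" for i j
  have tr: "(-1) ^ l * mat_trace (A ^\<^sub>m (k + l)) =
      (\<Sum>i<n. \<Sum>j<n. (A ^\<^sub>m k) $$ (i, j) * cnj ((A ^\<^sub>m l) $$ (i, j)))" for k l
  proof -
    have "(-1) ^ l * mat_trace (A ^\<^sub>m (k + l)) =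
      (\<Sum>i<n. \<Sum>j<n. (A ^\<^sub>m k) $$ (i, j) * ((-1) ^ l * (A ^\<^sub>m l) $$ (j, i)))"
      using A by (simp add: pow_mat_add[OF A] mat_trace_mult[of _ n] sum_distrib_left mult_ac)
    also have "\<dots> = (\<Sum>i<n. \<Sum>j<n. (A ^\<^sub>m k) $$ (i, j) * cnj ((A ^\<^sub>m l) $$ (i, j)))"
    proof (intro sum.cong refl)
      fix i j assume "i \<in> {..<n}" "j \<in> {..<n}"
      then show "(A ^\<^sub>m k) $$ (i, j) * ((-1) ^ l * (A ^\<^sub>m l) $$ (j, i)) =
          (A ^\<^sub>m k) $$ (i, j) * cnj ((A ^\<^sub>m l) $$ (i, j))"
        using skew_hermitian_pow[OF A skew, of i j l] by (cases "even l") auto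
    qed
    finally show ?thesis .
  qed
  \<comment> \<open>\<open>P\<close> is p(A) entrywise. Expanding its squared norm leads to the sum
    in \<open>zero\<close>; a vanishing sum of nonnegative reals then makes every entry
    vanish.\<close>
  have "complex_of_real (\<Sum>i<n. \<Sum>j<n. (cmod (P i j))\<^sup>2) = (\<Sum>i<n. \<Sum>j<n. P i j * cnj (P i j))"
    by (simp add: complex_norm_square del: of_real_power)
  also have "\<dots> = (\<Sum>i<n. \<Sum>j<n. \<Sum>k\<le>N. \<Sum>l\<le>N. coeff p k * cnj (coeff p l) *
      ((A ^\<^sub>m k) $$ (i, j) * cnj ((A ^\<^sub>m l) $$ (i, j))))"
    by (simp add: P_def sum_product mult_ac)
  also have "\<dots> = (\<Sum>k\<le>N. \<Sum>i<n. \<Sum>j<n. \<Sum>l\<le>N. coeff p k * cnj (coeff p l) *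
      ((A ^\<^sub>m k) $$ (i, j) * cnj ((A ^\<^sub>m l) $$ (i, j))))"
    by (rule sum_swap_twice[symmetric])
  also have "\<dots> = (\<Sum>k\<le>N. \<Sum>l\<le>N. \<Sum>i<n. \<Sum>j<n. coeff p k * cnj (coeff p l) *
      ((A ^\<^sub>m k) $$ (i, j) * cnj ((A ^\<^sub>m l) $$ (i, j))))"
    by (intro sum.cong refl sum_swap_twice[symmetric])
  also have "\<dots> = (\<Sum>k\<le>N. \<Sum>l\<le>N. coeff p k * cnj (coeff p l) *
      (\<Sum>i<n. \<Sum>j<n. (A ^\<^sub>m k) $$ (i, j) * cnj ((A ^\<^sub>m l) $$ (i, j))))"
    by (simp only: sum_distrib_left)
  also have "\<dots> = 0"
    using zero by (simp add: mult.assoc flip: tr)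
  finally have "(\<Sum>i<n. \<Sum>j<n. (cmod (P i j))\<^sup>2) = 0"
    by (simp only: of_real_eq_0_iff)
  then have "P i j = 0" if "i < n" "j < n" for i j
    using that by (simp add: sum_nonneg_eq_0_iff sum_nonneg)
  then show ?thesis
    using A by (simp add: annihilates_iff[OF deg] P_def)
qed

section \<open>The minimal polynomial read off from the traces\<close>

theorem theorem4p4:
  fixes Y :: "complex mat"
  assumes "Y \<in> sp4 \<or> Y \<in> sp4_hat"
  shows "min_poly Y \<in>
          {[:0, 1:],
           [:complex_of_real ((frobenius_norm Y)\<^sup>2 / 4), 0, 1:],
           [:0, complex_of_real ((frobenius_norm Y)\<^sup>2 / 2), 0, 1:],
           [:det Y, 0, complex_of_real ((frobenius_norm Y)\<^sup>2 / 2), 0, 1:]}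
    \<and> (min_poly Y = [:0, 1:] \<longleftrightarrow> Y = 0\<^sub>m 4 4)
    \<and> (min_poly Y = [:complex_of_real ((frobenius_norm Y)\<^sup>2 / 4), 0, 1:] \<longleftrightarrow>
         Y \<noteq> 0\<^sub>m 4 4 \<and> complex_of_real (frobenius_norm Y ^ 4) = 16 * det Y)
    \<and> (min_poly Y = [:0, complex_of_real ((frobenius_norm Y)\<^sup>2 / 2), 0, 1:] \<longleftrightarrow>
         Y \<noteq> 0\<^sub>m 4 4 \<and> det Y = 0)
    \<and> (min_poly Y = [:det Y, 0, complex_of_real ((frobenius_norm Y)\<^sup>2 / 2), 0, 1:] \<longleftrightarrow>
         Y \<noteq> 0\<^sub>m 4 4 \<and> complex_of_real (frobenius_norm Y ^ 4) \<noteq> 16 * det Y \<and> det Y \<noteq> 0)"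
proof -
  have Y: "Y \<in> carrier_mat 4 4" and skew: "mat_adjoint Y = - Y"
    and symp: "Y\<^sup>T * J_mat 2 = - J_mat 2 * Y \<or> Y\<^sup>T * J4_hat = - J4_hat * Y"
    using assms by (auto simp: sp4_def sp4_hat_def)
  define r where "r = complex_of_real ((frobenius_norm Y)\<^sup>2)"
  define d where "d = det Y"
  define t where "t k = mat_trace (Y ^\<^sub>m k)" for k
  have norm4: "complex_of_real (frobenius_norm Y ^ 4) = r\<^sup>2"
    by (simp add: r_def power2_eq_square power4_eq_xxxx)
  have cnj_r: "cnj r = r"
    by (simp add: r_def)
  have t0: "t 0 = 4"
    using Y by (simp add: t_def mat_trace_def)
  have t1: "t 1 = 0" and t3: "t 3 = 0"
    using symplectic_powers(1,2)[OF Y symp] Y by (simp_all add: t_def)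
  have t2: "t 2 = - r"
  proof -
    have "r = mat_trace (- (Y * Y))"
      using Y by (simp add: r_def frobenius_norm_squared skew del: of_real_power)
    also have "\<dots> = - t 2"
      using Y by (simp add: t_def mat_trace_def numeral_2_eq_2 sum_negf)
    finally show ?thesis by simp
  qed
  \<comment> \<open>The quartic annihilates \<open>Y\<close> in every case, by the formula for the
    fourth power and \<open>t2\<close>; it also supplies the recurrence \<open>rec\<close>.\<close>
  have p4: "annihilates [:d, 0, r / 2, 0, 1:] Y"
  proof -
    have "degree [:d, 0, r / 2, 0, 1:] \<le> 4" by simp
    from annihilates_iff[OF this, of Y] show ?thesis
      using Y t2 symplectic_powers(3)[OF Y symp]
      by (simp add: t_def d_def eval_nat_numeral)
  qed
  have sum3: "(\<Sum>k\<le>3. f k) = f 0 + f 1 + f 2 + f 3" for f :: "nat \<Rightarrow> complex"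
    by (simp add: numeral_eq_Suc)
  \<comment> \<open>Trace of the quartic at \<open>Y\<close> times Y^m. The cases m = 0, 1, 2 give
    \<open>t\<close> up to index 6, which is all that polynomials of degree at most 3 need, since k
    + l \<le> 6.\<close>
  have rec: "d * t m + r / 2 * t (2 + m) + t (4 + m) = 0" for m
  proof -
    have "(\<Sum>k\<le>4. f k) = f 0 + f 1 + f 2 + f 3 + f 4" for f :: "nat \<Rightarrow> complex"
      by (simp add: numeral_eq_Suc)
    then show ?thesis
      using annihilates_imp_trace_sum_eq_0[OF Y p4, of 4 m]
      by (simp add: t_def coeff_pCons eval_nat_numeral)
  qed
  have t4: "t 4 = r\<^sup>2 / 2 - 4 * d"
    using rec[of 0] t0 t2 by (simp add: numeral_2_eq_2 algebra_simps)
  have t5: "t 5 = 0"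
    using rec[of 1] t1 t3 by simp
  have t6: "t 6 = 3 * d * r - r ^ 3 / 4"
    using rec[of 2] t2 t4 by (simp add: power2_eq_square power3_eq_cube field_simps)
  note t = t0 t1 t2 t3 t4 t5 t6
  have annI: "annihilates p Y"
    if "degree p \<le> 3" "(\<Sum>k\<le>3. \<Sum>l\<le>3. coeff p k * cnj (coeff p l) * (-1) ^ l * t (k + l)) = 0" for p
    using skew_hermitian_annihilatesI[OF Y skew that(1)] that(2) by (simp add: t_def)
  have coeffs: "coeff (pCons a p) 1 = coeff p 0" "coeff (pCons a p) 2 = coeff p 1"
    "coeff (pCons a p) 3 = coeff p 2" for a and p :: "complex poly"
    by (simp_all add: coeff_pCons numeral_eq_Suc)
  have zero_iff: "annihilates [:0, 1:] Y \<longleftrightarrow> Y = 0\<^sub>m 4 4"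
    using Y annihilates_iff[of "[:0, 1:]" 1 Y] by auto
  have r0: "r = 0 \<longleftrightarrow> Y = 0\<^sub>m 4 4"
  proof
    assume "r = 0"
    \<comment> \<open>For the polynomial x the double sum in \<open>annI\<close> is -t 2 =
      r.\<close>
    then have "annihilates [:0, 1:] Y"
      by (intro annI) (simp_all add: sum3 t coeffs del: One_nat_def)
    then show "Y = 0\<^sub>m 4 4"
      by (simp add: zero_iff)
  next
    assume "Y = 0\<^sub>m 4 4"
    then have "t 2 = 0"
      by (simp add: t_def mat_trace_def numeral_2_eq_2)
    then show "r = 0"
      by (simp add: t2)
  qed
  \<comment> \<open>Rows 0 to 3 of the Hankel system. As the odd traces vanish, it splits into a
    system for the coefficients 0 and 2, of determinant \<open>r\<^sup>2 - 16 * d\<close>, and one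
    for 1 and 3, of determinant \<open>d * (r\<^sup>2 - 16 * d)\<close>.\<close>
  have hankel: "4 * coeff q 0 = r * coeff q 2 \<and> (r\<^sup>2 - 16 * d) * coeff q 2 = 0 \<and>
      2 * r * coeff q 1 = (r\<^sup>2 - 8 * d) * coeff q 3 \<and> d * (r\<^sup>2 - 16 * d) * coeff q 3 = 0"
    if q: "annihilates q Y" "degree q \<le> 3" for q
  proof -
    note tr = annihilates_imp_trace_sum_eq_0[OF Y q, folded t_def]
    have eqs: "4 * coeff q 0 = r * coeff q 2" "2 * r * coeff q 0 = (r\<^sup>2 - 8 * d) * coeff q 2"
      "2 * r * coeff q 1 = (r\<^sup>2 - 8 * d) * coeff q 3"
      "4 * (r\<^sup>2 - 8 * d) * coeff q 1 = 2 * (r ^ 3 - 12 * d * r) * coeff q 3"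
      using tr[of 0] tr[of 1] tr[of 2] tr[of 3]
      by (simp_all add: sum3 t field_simps del: One_nat_def add_2_eq_Suc add_2_eq_Suc')
    \<comment> \<open>Eliminates \<open>coeff q 0\<close>: twice the second equation minus
      \<open>r\<close> times the first.\<close>
    have "(r\<^sup>2 - 16 * d) * coeff q 2 = 2 * ((r\<^sup>2 - 8 * d) * coeff q 2) - r * (r * coeff q 2)"
      by (simp add: power2_eq_square algebra_simps)
    also have "\<dots> = 0"
      by (simp flip: eqs(1,2))
    finally have c2: "(r\<^sup>2 - 16 * d) * coeff q 2 = 0" .
    \<comment> \<open>Eliminates \<open>coeff q 1\<close>: \<open>r\<close> times the fourth
      equation minus \<open>2 * (r\<^sup>2 - 8 * d)\<close> times the third.\<close>
    have "8 * (d * (r\<^sup>2 - 16 * d) * coeff q 3) = r * (2 * (r ^ 3 - 12 * d * r) * coeff q 3)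
        - 2 * (r\<^sup>2 - 8 * d) * ((r\<^sup>2 - 8 * d) * coeff q 3)"
      by (simp add: power2_eq_square power3_eq_cube algebra_simps)
    also have "\<dots> = 0"
      by (simp only: eqs(3,4)[symmetric]) (simp add: algebra_simps)
    finally show ?thesis
      using eqs c2 by simp
  qed
  \<comment> \<open>Below degree 2 the coefficients 2 and 3 are zero, and with
    \<open>r \<noteq> 0\<close> the equations of \<open>hankel\<close> kill 0 and 1 too, so
    \<open>q\<close> cannot be monic.\<close>
  have deg2: "2 \<le> degree q" if "r \<noteq> 0" "monic q" "annihilates q Y" for q
  proof (rule ccontr)
    assume "\<not> 2 \<le> degree q"
    then have "coeff q 2 = 0" "coeff q 3 = 0" "degree q = 0 \<or> degree q = 1"
      by (auto simp: coeff_eq_0)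
    then show False
      using hankel[of q] that by auto
  qed
  \<comment> \<open>A monic \<open>q\<close> of degree 2 has \<open>coeff q 2 = 1\<close>, and the
    second equation of \<open>hankel\<close> would give r^2 = 16 d; \<open>deg4\<close> argues
    likewise with \<open>coeff q 3\<close> and the fourth equation.\<close>
  have deg3: "3 \<le> degree q" if "r \<noteq> 0" "r\<^sup>2 \<noteq> 16 * d" "monic q" "annihilates q Y" for q
    using deg2[of q] hankel[of q] that by (cases "degree q = 2") auto
  have deg4: "4 \<le> degree q" if "r \<noteq> 0" "r\<^sup>2 \<noteq> 16 * d" "d \<noteq> 0" "monic q" "annihilates q Y" for q
    using deg3[of q] hankel[of q] that by (cases "degree q = 3") auto
  have main: "min_poly Y \<in> {[:0, 1:], [:r / 4, 0, 1:], [:0, r / 2, 0, 1:], [:d, 0, r / 2, 0, 1:]}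
    \<and> (min_poly Y = [:0, 1:] \<longleftrightarrow> r = 0)
    \<and> (min_poly Y = [:r / 4, 0, 1:] \<longleftrightarrow> r \<noteq> 0 \<and> r\<^sup>2 = 16 * d)
    \<and> (min_poly Y = [:0, r / 2, 0, 1:] \<longleftrightarrow> r \<noteq> 0 \<and> d = 0)
    \<and> (min_poly Y = [:d, 0, r / 2, 0, 1:] \<longleftrightarrow> r \<noteq> 0 \<and> r\<^sup>2 \<noteq> 16 * d \<and> d \<noteq> 0)"
  proof -
    \<comment> \<open>The candidates have degrees 1 to 4, so they are distinct and one case settles
      all equivalences. If r \<noteq> 0 and r^2 = 16 d, then d \<noteq> 0 and the quartic is the
      square of x^2 + r/4; hence the last equivalence must exclude r^2 = 16 d explicitly.\<close>
    consider "r = 0" | "r \<noteq> 0" "r\<^sup>2 = 16 * d" | "r \<noteq> 0" "r\<^sup>2 \<noteq> 16 * d" "d = 0"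
      | "r \<noteq> 0" "r\<^sup>2 \<noteq> 16 * d" "d \<noteq> 0"
      by blast
    then show ?thesis
    proof cases
      case 1
      \<comment> \<open>A monic constant is 1, but with r = 0 \<open>hankel\<close> gives
        \<open>coeff q 0 = 0\<close>.\<close>
      have "1 \<le> degree q" if "monic q" "annihilates q Y" for q
        using hankel[of q] that 1 by (cases "degree q = 0") auto
      then have "min_poly Y = [:0, 1:]"
        using 1 r0 zero_iff by (intro min_poly_eqI) (auto simp: is_min_poly_def)
      then show ?thesis
        using 1 by simp
    next
      case 2
      \<comment> \<open>Here the double sum in \<open>annI\<close> equals (r^2 - 16 d) / 4.\<close>
      have "annihilates [:r / 4, 0, 1:] Y"
        using 2 by (intro annI)
          (simp_all add: sum3 t cnj_r coeffs power2_eq_square power3_eq_cube field_simps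
            del: One_nat_def add_2_eq_Suc add_2_eq_Suc')
      then have "min_poly Y = [:r / 4, 0, 1:]"
        using 2 deg2 by (intro min_poly_eqI) (auto simp: is_min_poly_def numeral_2_eq_2)
      then show ?thesis
        using 2 by auto
    next
      case 3
      \<comment> \<open>Here the double sum equals d r.\<close>
      have "annihilates [:0, r / 2, 0, 1:] Y"
        using 3 by (intro annI)
          (simp_all add: sum3 t cnj_r coeffs power2_eq_square power3_eq_cube field_simps
            del: One_nat_def add_2_eq_Suc add_2_eq_Suc')
      then have "min_poly Y = [:0, r / 2, 0, 1:]"
        using 3 deg3 by (intro min_poly_eqI) (auto simp: is_min_poly_def numeral_eq_Suc)
      then show ?thesis
        using 3 by auto
    next
      case 4
      then have "min_poly Y = [:d, 0, r / 2, 0, 1:]"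
        using p4 deg4 by (intro min_poly_eqI) (auto simp: is_min_poly_def numeral_eq_Suc)
      then show ?thesis
        using 4 by auto
    qed
  qed
  have half_quarter: "complex_of_real ((frobenius_norm Y)\<^sup>2 / 4) = r / 4"
    "complex_of_real ((frobenius_norm Y)\<^sup>2 / 2) = r / 2"
    by (simp_all add: r_def)
  show ?thesis
    using main unfolding norm4 half_quarter r0 d_def .
qed

end
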